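(* Let $G$ be a graph on $n$ vertices and let $X\in M_n(\mathbb{R})$. Then $$\|X+\mathcal{S}_G^{\perp}\|_{\mathrm{osy}}=\max\Big\{2\operatorname{Tr}(X^TB):\begin{pmatrix} A & B \\ B^T & C \end{pmatrix}\in M_2(\mathcal{S}_G)^+,\ \operatorname{Tr}(A+C)=1\Big\},$$ where the maximum is over $A,B,C\in M_n(\mathbb{R})$.
   Context: $M_n$ denotes the complex $n\times n$ matrices with matrix units $E_{i,j}$; $M_n(\mathbb{R})$ the real matrices; $X^T$ the transpose. A graph $G$ on $n$ vertices is a symmetric subset $G\subseteq\{1,\dots,n\}^2$ containing no $(i,i)$; $\widetilde G=G\cup\{(i,i):1\le i\le n\}$; $\mathcal{S}_G=\operatorname{span}\{E_{i,j}:(i,j)\in\widetilde G\}\subseteq M_n$, and $\mathcal{S}_G^\perp=\operatorname{span}\{E_{i,j}:(i,j)\notin\widetilde G\}$ is its orthogonal complement for the inner product $\operatorname{tr}(ab^* )$. $M_2(\mathcal{S}_G)^+$ is the set of positive semidefinite matrices in $M_{2n}=M_2(M_n)$ all four of whose $n\times n$ blocks lie in $\mathcal{S}_G$. The operator system quotient norm is $$\|X+\mathcal{S}_G^{\perp}\|_{\mathrm{osy}}=\inf\Big\{\lambda:\begin{pmatrix} \lambda I+K_1 & X+K_2 \\ X^*+K_2^* & \lambda I+K_3 \end{pmatrix}\in M_2(M_n)^+\text{ for some }K_1,K_2,K_3\in\mathcal{S}_G^\perp\Big\}.$$ *)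

theory Defs
  imports "HOL-Analysis.Analysis"
begin

text \<open>The index set of the vertices is a finite type \<open>'n\<close>, so a graph on n = \<open>CARD('n)\<close> vertices
  is a symmetric irreflexive relation on \<open>'n\<close>.\<close>

definition graph_on :: "('n::finite \<times> 'n) set \<Rightarrow> bool" where
  "graph_on G \<longleftrightarrow> sym G \<and> irrefl G"

definition graph_refl :: "('n::finite \<times> 'n) set \<Rightarrow> ('n \<times> 'n) set" where
  "graph_refl G = G \<union> Id"

definition matrix_unit :: "'n::finite \<Rightarrow> 'n \<Rightarrow> complex^'n^'n" where
  "matrix_unit i j = (\<chi> a b. if a = i \<and> b = j then 1 else 0)"

text \<open>The constant \<open>span\<close> of the library is the real span; the operator systems need the span over
  the complex numbers, which the following interpretation provides as \<open>cmat.span\<close>.\<close>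

definition cmat_scale :: "complex \<Rightarrow> complex^'n^'m \<Rightarrow> complex^'n^'m" where
  "cmat_scale c = map_matrix ((*) c)"

global_interpretation cmat: vector_space "cmat_scale :: complex \<Rightarrow> complex^'n^'m \<Rightarrow> complex^'n^'m"
  by standard (simp_all add: cmat_scale_def vec_eq_iff algebra_simps)

definition graph_system :: "('n::finite \<times> 'n) set \<Rightarrow> (complex^'n^'n) set" where
  "graph_system G = cmat.span {matrix_unit i j | i j. (i, j) \<in> graph_refl G}"

definition graph_system_perp :: "('n::finite \<times> 'n) set \<Rightarrow> (complex^'n^'n) set" where
  "graph_system_perp G = cmat.span {matrix_unit i j | i j. (i, j) \<notin> graph_refl G}"

definition cadjoint :: "complex^'n^'m \<Rightarrow> complex^'m^'n" where
  "cadjoint A = map_matrix cnj (transpose A)"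

definition pos_semidef :: "complex^'n^'n \<Rightarrow> bool" where
  "pos_semidef A \<longleftrightarrow> cadjoint A = A \<and> (\<forall>x. 0 \<le> Re (\<Sum>i\<in>UNIV. cnj (x $ i) * (A *v x) $ i))"

definition block2 :: "'a^'n^'n \<Rightarrow> 'a^'n^'n \<Rightarrow> 'a^'n^'n \<Rightarrow> 'a^'n^'n \<Rightarrow> 'a^('n + 'n)^('n::finite + 'n)" where
  "block2 A B C D = (\<chi> i j. case i of
      Inl a \<Rightarrow> (case j of Inl b \<Rightarrow> A $ a $ b | Inr b \<Rightarrow> B $ a $ b)
    | Inr a \<Rightarrow> (case j of Inl b \<Rightarrow> C $ a $ b | Inr b \<Rightarrow> D $ a $ b))"

definition M2_pos :: "(complex^'n^'n) set \<Rightarrow> (complex^('n + 'n)^('n::finite + 'n)) set" where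
  "M2_pos S = {block2 A B C D | A B C D.
      A \<in> S \<and> B \<in> S \<and> C \<in> S \<and> D \<in> S \<and> pos_semidef (block2 A B C D)}"

text \<open>The norm of the coset of \<open>X\<close>, written as a function of the representative \<open>X\<close>. The set
  below is nonempty (take \<open>\<lambda>\<close> large) and bounded below by 0 (the matrices in \<open>graph_system_perp G\<close>
  have zero diagonal), so the infimum over the reals is the usual one.\<close>

definition osy_norm :: "('n::finite \<times> 'n) set \<Rightarrow> complex^'n^'n \<Rightarrow> real" where
  "osy_norm G X = Inf {l :: real.
      \<exists>K1 \<in> graph_system_perp G. \<exists>K2 \<in> graph_system_perp G. \<exists>K3 \<in> graph_system_perp G.
        block2 (mat (of_real l) + K1) (X + K2)
               (cadjoint X + cadjoint K2) (mat (of_real l) + K3) \<in> M2_pos UNIV}"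

text \<open>The library's \<open>Max\<close> is meant for finite sets only.\<close>

definition is_maximum :: "real \<Rightarrow> real set \<Rightarrow> bool" where
  "is_maximum m S \<longleftrightarrow> m \<in> S \<and> (\<forall>s\<in>S. s \<le> m)"

end

theory Submission
  imports Defs
begin

text \<open>The identity is strong duality for a pair of semidefinite programs. The norm is the infimum of the
  numbers \<open>\<lambda>\<close> for which the matrix with blocks \<open>\<lambda> I\<close>, \<open>X\<close>, \<open>X\<^sup>T\<close>, \<open>\<lambda> I\<close> can be made positive semidefinite
  by changing entries outside the pattern of the graph; call such \<open>\<lambda>\<close> admissible. The dual variables are
  positive semidefinite block matrices of trace 1 supported on the pattern.

  Since \<open>X\<close> is real, taking real parts reduces admissibility to real matrices
  (\<open>osy_admissible_of_real\<close>). Pairing a primal with a dual matrix by the trace inner product makes the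
  off-pattern entries disappear, and positivity of the pairing shows that each dual value is at most each
  admissible \<open>\<lambda>\<close> (\<open>weak_duality\<close>). Positivity of the pairing is the inclusion of the semidefinite cone
  in its dual, which follows by Gaussian elimination (\<open>nonneg_form_inner_nonneg\<close>).

  For the converse, let \<open>L\<close> be a nonempty convex set of numbers none of which is admissible. The matrices
  that agree on the pattern with the primal matrix of some \<open>\<lambda>\<close> in \<open>L\<close> form a convex set that misses the
  positive definite cone. The normal vector of a separating hyperplane, scaled and with a change of sign,
  is a dual solution whose value is at least every element of \<open>L\<close> (\<open>dual_certificate\<close>). With \<open>L\<close> the
  whole line this shows that some number is admissible. With \<open>L\<close> the open half-line below the
  infimum it gives a single dual solution whose value is at least the infimum, so the maximum is attained.\<close>

section \<open>Matrix spaces spanned by matrix units\<close>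

lemma span_matrix_units:
  "cmat.span {matrix_unit i j | i j. (i, j) \<in> R} =
    {A. \<forall>i j. (i, j) \<notin> R \<longrightarrow> A $ i $ j = 0}" (is "cmat.span ?U = ?Z")
proof
  have "?U \<subseteq> ?Z"
    by (auto simp: matrix_unit_def)
  moreover have "cmat.subspace ?Z"
    by (auto simp: cmat.subspace_def cmat_scale_def)
  ultimately show "cmat.span ?U \<subseteq> ?Z"
    by (rule cmat.span_minimal)
  show "?Z \<subseteq> cmat.span ?U"
  proof
    fix A assume A: "A \<in> ?Z"
    have "A = (\<Sum>(i, j)\<in>R. cmat_scale (A $ i $ j) (matrix_unit i j))"
    unfolding vec_eq_iff
    proof (intro allI)
      fix a b
      have "(\<Sum>(i, j)\<in>R. cmat_scale (A $ i $ j) (matrix_unit i j)) $ a $ b =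
          (\<Sum>p\<in>R. if p = (a, b) then A $ a $ b else 0)"
        unfolding sum_component
        by (rule sum.cong) (auto simp: cmat_scale_def matrix_unit_def split: if_splits)
      also have "\<dots> = A $ a $ b"
        using A by (auto simp: sum.delta[OF finite])
      finally show "A $ a $ b =
        (\<Sum>(i, j)\<in>R. cmat_scale (A $ i $ j) (matrix_unit i j)) $ a $ b" by simp
    qed
    also have "\<dots> \<in> cmat.span ?U"
      by (rule cmat.span_sum) (auto intro: cmat.span_scale cmat.span_base)
    finally show "A \<in> cmat.span ?U" .
  qed
qed

lemma mem_graph_system:
  "A \<in> graph_system G \<longleftrightarrow> (\<forall>i j. (i, j) \<notin> graph_refl G \<longrightarrow> A $ i $ j = 0)"
  by (simp add: graph_system_def span_matrix_units)

lemma mem_graph_system_perp: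
  "A \<in> graph_system_perp G \<longleftrightarrow> (\<forall>i j. (i, j) \<in> graph_refl G \<longrightarrow> A $ i $ j = 0)"
  using span_matrix_units[of "- graph_refl G"] by (simp add: graph_system_perp_def)

section \<open>Real matrices with nonnegative quadratic form\<close>

text \<open>Symmetry is deliberately not part of this notion. The cone of such matrices is then full-dimensional
  in the space of all real matrices, so its positive definite members can be separated from a convex
  set by a hyperplane in that space, and the symmetry of the normal vector comes out as a result.\<close>

definition nonneg_form :: "real^'m^'m \<Rightarrow> bool" where
  "nonneg_form M \<longleftrightarrow> (\<forall>x. 0 \<le> x \<bullet> (M *v x))"

lemma symmetric_nth: "transpose Q = Q \<Longrightarrow> Q $ i $ j = Q $ j $ i"
  by (metis transpose_def vec_lambda_beta)

lemma transpose_uminus: "transpose (- A) = - transpose (A :: 'a::uminus^'n^'m)"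
  by (simp add: vec_eq_iff transpose_def)

lemma quadratic_form_sum:
  fixes M :: "real^'m^'m"
  shows "x \<bullet> (M *v y) = (\<Sum>i\<in>UNIV. \<Sum>j\<in>UNIV. x $ i * M $ i $ j * y $ j)"
  by (simp add: inner_vec_def matrix_vector_mult_def sum_distrib_left mult.assoc)

lemma bilinear_form_symmetric:
  fixes M :: "real^'m^'m"
  assumes "transpose M = M"
  shows "x \<bullet> (M *v y) = y \<bullet> (M *v x)"
  by (metis assms dot_lmul_matrix inner_commute vector_transpose_matrix)

lemma cadjoint_of_real:
  "cadjoint (map_matrix complex_of_real M) = map_matrix complex_of_real (transpose M)"
  by (simp add: cadjoint_def vec_eq_iff transpose_def)

text \<open>For real coefficients the real and imaginary parts of the vector do not interact. Hence real
  vectors suffice to test whether a real matrix is positive semidefinite over the complex numbers.\<close>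

lemma complex_form_of_real:
  fixes M :: "real^'m^'m" and x :: "complex^'m"
  shows "Re (\<Sum>i\<in>UNIV. cnj (x $ i) * (map_matrix complex_of_real M *v x) $ i) =
    (\<chi> i. Re (x $ i)) \<bullet> (M *v (\<chi> i. Re (x $ i))) +
    (\<chi> i. Im (x $ i)) \<bullet> (M *v (\<chi> i. Im (x $ i)))"
  unfolding quadratic_form_sum
  by (simp add: matrix_vector_mult_def sum_distrib_left sum.distrib[symmetric] algebra_simps)

lemma complex_form_at_real:
  fixes P :: "complex^'m^'m" and x :: "real^'m"
  shows "Re (\<Sum>i\<in>UNIV. cnj (complex_of_real (x $ i)) *
      (P *v (\<chi> j. complex_of_real (x $ j))) $ i) = x \<bullet> (map_matrix Re P *v x)"
  unfolding quadratic_form_sum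
  by (simp add: matrix_vector_mult_def sum_distrib_left algebra_simps)

lemma pos_semidef_Re:
  assumes "pos_semidef P"
  shows "nonneg_form (map_matrix Re P)"
  unfolding nonneg_form_def
proof
  fix x
  show "0 \<le> x \<bullet> (map_matrix Re P *v x)"
    using assms complex_form_at_real[of x P] unfolding pos_semidef_def
    by (metis (no_types, lifting) ext sum.cong vec_lambda_beta)
qed

lemma pos_semidef_of_real:
  "pos_semidef (map_matrix complex_of_real M) \<longleftrightarrow> transpose M = M \<and> nonneg_form M"
proof -
  have "cadjoint (map_matrix complex_of_real M) = map_matrix complex_of_real M \<longleftrightarrow> transpose M = M"
    by (simp add: cadjoint_of_real vec_eq_iff)
  moreover have "nonneg_form M" if "pos_semidef (map_matrix complex_of_real M)"
  proof -
    have "map_matrix Re (map_matrix complex_of_real M) = M"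
      by (simp add: vec_eq_iff)
    with pos_semidef_Re[OF that] show ?thesis by simp
  qed
  ultimately show ?thesis
    unfolding pos_semidef_def complex_form_of_real nonneg_form_def by auto
qed

definition outer :: "real^'m \<Rightarrow> real^'m \<Rightarrow> real^'m^'m" where
  "outer x y = (\<chi> i j. x $ i * y $ j)"

lemma outer_mult_vec: "outer x y *v z = (y \<bullet> z) *\<^sub>R x"
  by (simp add: vec_eq_iff outer_def matrix_vector_mult_def inner_vec_def sum_distrib_left mult_ac)

lemma inner_outer: "M \<bullet> outer x y = x \<bullet> (M *v y)"
  by (simp add: inner_vec_def outer_def matrix_vector_mult_def sum_distrib_left mult_ac)

lemma nonneg_form_diag:
  assumes "nonneg_form M"
  shows "0 \<le> M $ i $ i"
proof -
  have "axis i 1 \<bullet> (M *v axis i 1) = M $ i $ i"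
    by (simp add: matrix_vector_mult_basis inner_axis' column_def)
  then show ?thesis
    using assms by (metis nonneg_form_def)
qed

text \<open>When \<open>M\<^sub>i\<^sub>i = 0\<close>, the form is \<open>M\<^sub>j\<^sub>j + 2 t M\<^sub>i\<^sub>j\<close> along the line
  \<open>e\<^sub>j + t e\<^sub>i\<close>; a nonconstant affine function of \<open>t\<close> takes negative values.\<close>

lemma nonneg_form_zero_diag:
  assumes sym: "transpose M = M" and M: "nonneg_form M" and i: "M $ i $ i = 0"
  shows "M $ i $ j = 0"
proof (rule ccontr)
  assume nz: "M $ i $ j \<noteq> 0"
  \<comment> \<open>the point where that affine function takes the value -1\<close>
  define t where "t = - (M $ j $ j + 1) / (2 * M $ i $ j)"
  have ji: "M $ j $ i = M $ i $ j"
    by (rule symmetric_nth[OF sym])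
  have "(axis j 1 + t *\<^sub>R axis i 1) \<bullet> (M *v (axis j 1 + t *\<^sub>R axis i 1)) =
      M $ j $ j + 2 * t * M $ i $ j + t * t * M $ i $ i"
    by (simp add: matrix_vector_right_distrib inner_left_distrib inner_right_distrib
        matrix_vector_mult_scaleR matrix_vector_mult_basis inner_axis' column_def ji
        algebra_simps)
  also have "\<dots> = - 1"
    using nz i by (simp add: t_def field_simps)
  finally show False
    using M unfolding nonneg_form_def by (metis neg_0_le_iff_le not_one_le_zero)
qed

text \<open>One step of symmetric Gaussian elimination: the form of the new matrix at \<open>x\<close> is the minimum of
  the form of \<open>M\<close> on the line \<open>x + \<real> e\<^sub>i\<close>, which is attained at \<open>x - c e\<^sub>i\<close> with the \<open>c\<close> below.\<close>

lemma nonneg_form_schur_complement: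
  assumes sym: "transpose M = M" and M: "nonneg_form M" and i: "0 < M $ i $ i"
  shows "nonneg_form (M - (1 / M $ i $ i) *\<^sub>R outer (M $ i) (M $ i))"
  unfolding nonneg_form_def
proof
  fix x
  define c where "c = (M $ i \<bullet> x) / M $ i $ i"
  have row: "(M *v x) $ i = M $ i \<bullet> x"
    by (simp add: matrix_vector_mult_def inner_vec_def)
  have xi: "x \<bullet> (M *v axis i 1) = M $ i \<bullet> x"
    by (simp add: bilinear_form_symmetric[OF sym, of x] inner_axis' row)
  have "0 \<le> (x - c *\<^sub>R axis i 1) \<bullet> (M *v (x - c *\<^sub>R axis i 1))"
    using M by (simp add: nonneg_form_def)
  also have "\<dots> = x \<bullet> (M *v x) - 2 * c * (M $ i \<bullet> x) + c * c * M $ i $ i"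
    by (simp add: matrix_vector_mult_diff_distrib inner_diff_left inner_diff_right
        matrix_vector_mult_scaleR xi inner_axis' row)
       (simp add: matrix_vector_mult_basis column_def algebra_simps)
  also have "\<dots> = x \<bullet> (M *v x) - (M $ i \<bullet> x) * (M $ i \<bullet> x) / M $ i $ i"
    using i by (simp add: c_def field_simps)
  also have "\<dots> = x \<bullet> ((M - (1 / M $ i $ i) *\<^sub>R outer (M $ i) (M $ i)) *v x)"
    by (simp add: matrix_vector_mult_diff_rdistrib inner_diff_right outer_mult_vec
        scaleR_matrix_vector_assoc[symmetric] inner_commute)
  finally show "0 \<le> x \<bullet> ((M - (1 / M $ i $ i) *\<^sub>R outer (M $ i) (M $ i)) *v x)" .
qed

text \<open>The cone of positive semidefinite matrices lies in its own dual. Each elimination step splits off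
  a nonnegative multiple of some \<open>v v\<^sup>T\<close>, whose inner product with \<open>R\<close> is \<open>v \<bullet> R v \<ge> 0\<close>, and clears a
  diagonal entry for good. A matrix of nonnegative form with zero diagonal is zero, so \<open>Q\<close> is a
  sum of such multiples.\<close>

lemma nonneg_form_inner_nonneg:
  assumes "transpose Q = Q" and "nonneg_form Q" and R: "nonneg_form R"
  shows "0 \<le> Q \<bullet> R"
  using assms(1,2)
proof (induction "card {i. Q $ i $ i \<noteq> 0}" arbitrary: Q rule: less_induct)
  case less
  note sym = less.prems(1) and Q = less.prems(2)
  show ?case
  proof (cases "\<exists>i. Q $ i $ i \<noteq> 0")
    case False
    then have "Q = 0"
      using nonneg_form_zero_diag[OF sym Q] by (simp add: vec_eq_iff)
    then show ?thesis by simp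
  next
    case True
    then obtain i where nz: "Q $ i $ i \<noteq> 0" by blast
    with nonneg_form_diag[OF Q, of i] have i: "0 < Q $ i $ i" by simp
    define S where "S = Q - (1 / Q $ i $ i) *\<^sub>R outer (Q $ i) (Q $ i)"
    have S: "nonneg_form S"
      unfolding S_def by (rule nonneg_form_schur_complement[OF sym Q i])
    have symS: "transpose S = S"
      using sym by (simp add: S_def vec_eq_iff transpose_def outer_def)
    have "S $ k $ k = 0" if "Q $ k $ k = 0" for k
    proof -
      have "Q $ i $ k = 0"
        using nonneg_form_zero_diag[OF sym Q that, of i] symmetric_nth[OF sym] by simp
      with that show ?thesis by (simp add: S_def outer_def)
    qed
    moreover have "S $ i $ i = 0"
      using nz by (simp add: S_def outer_def)
    ultimately have "{k. S $ k $ k \<noteq> 0} \<subset> {k. Q $ k $ k \<noteq> 0}"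
      using nz by auto
    then have "0 \<le> S \<bullet> R"
      using less.hyps[OF _ symS S] by (simp add: psubset_card_mono)
    moreover have "Q \<bullet> R = S \<bullet> R + (1 / Q $ i $ i) * (R \<bullet> outer (Q $ i) (Q $ i))"
      by (simp add: S_def inner_diff_left inner_commute[of R])
    moreover have "0 \<le> R \<bullet> outer (Q $ i) (Q $ i)"
      using R by (simp add: inner_outer nonneg_form_def)
    ultimately show ?thesis
      using i by simp
  qed
qed

text \<open>The normal vector \<open>Q\<close> of a hyperplane that separates \<open>V\<close> from the positive definite cone is
  nonnegative on the closure of that cone. Testing it against \<open>x x\<^sup>T\<close> shows that its form is
  nonnegative, and testing it against \<open>\<plusminus>(x y\<^sup>T - y x\<^sup>T)\<close>, matrices whose form vanishes, shows that it is
  symmetric.\<close>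

lemma separate_from_positive_definite:
  fixes V :: "(real^'m^'m) set"
  assumes "convex V" and "V \<noteq> {}"
    and no_pd: "\<And>M. M \<in> V \<Longrightarrow> \<not> nonneg_form M"
  obtains Q where "Q \<noteq> 0" and "transpose Q = Q" and "nonneg_form Q"
    and "\<And>M. M \<in> V \<Longrightarrow> Q \<bullet> M \<le> 0"
proof -
  define T :: "(real^'m^'m) set" where "T = {M. \<forall>x. x \<noteq> 0 \<longrightarrow> 0 < x \<bullet> (M *v x)}"
  have shift: "N + e *\<^sub>R mat 1 \<in> T" if "nonneg_form N" and "0 < e" for N e
    using that
    by (auto simp: T_def nonneg_form_def matrix_vector_mult_add_rdistrib inner_right_distrib
        scaleR_matrix_vector_assoc[symmetric] intro!: add_nonneg_pos)
  have "convex T"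
  proof (rule convexI)
    fix M N and u v :: real
    assume MN: "M \<in> T" "N \<in> T" and uv: "0 \<le> u" "0 \<le> v" "u + v = 1"
    show "u *\<^sub>R M + v *\<^sub>R N \<in> T"
      unfolding T_def
    proof clarify
      fix x :: "real^'m" assume "x \<noteq> 0"
      with MN have "0 < x \<bullet> (M *v x)" "0 < x \<bullet> (N *v x)" by (auto simp: T_def)
      with uv have "0 < u * (x \<bullet> (M *v x)) + v * (x \<bullet> (N *v x))"
        by (cases "u = 0") (auto intro: add_pos_nonneg)
      then show "0 < x \<bullet> ((u *\<^sub>R M + v *\<^sub>R N) *v x)"
        by (simp add: matrix_vector_mult_add_rdistrib inner_right_distrib
            scaleR_matrix_vector_assoc[symmetric])
    qed
  qed
  moreover have "nonneg_form M" if "M \<in> T" for M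
    unfolding nonneg_form_def
  proof
    fix x show "0 \<le> x \<bullet> (M *v x)"
      using that by (cases "x = 0") (auto simp: T_def intro: less_imp_le)
  qed
  then have "V \<inter> T = {}"
    using no_pd by blast
  moreover have "T \<noteq> {}"
    using shift[of 0 1] by (auto simp: nonneg_form_def)
  ultimately obtain Q b where "Q \<noteq> 0" and V: "\<And>M. M \<in> V \<Longrightarrow> Q \<bullet> M \<le> b"
    and T: "\<And>M. M \<in> T \<Longrightarrow> b \<le> Q \<bullet> M"
    using separating_hyperplane_sets[of V T] assms(1,2) by blast
  \<comment> \<open>the matrices \<open>e I\<close> lie in the cone and tend to 0, where the functional vanishes\<close>
  have "b \<le> 0"
  proof (rule tendsto_lowerbound)
    show "((\<lambda>e. Q \<bullet> (e *\<^sub>R mat 1)) \<longlongrightarrow> 0) (at_right 0)"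
      by (auto intro!: tendsto_eq_intros)
    show "\<forall>\<^sub>F e in at_right 0. b \<le> Q \<bullet> (e *\<^sub>R mat 1)"
      using T[OF shift[of 0]] by (auto simp: nonneg_form_def intro!: eventually_at_rightI[of 0 1])
  qed simp
  have pos: "0 \<le> Q \<bullet> N" if N: "nonneg_form N" for N
  proof (rule ccontr)
    assume neg: "\<not> 0 \<le> Q \<bullet> N"
    \<comment> \<open>\<open>t N + I\<close> lies in the cone, but this \<open>t\<close> puts it below the bound \<open>b\<close>\<close>
    define t where "t = (\<bar>Q \<bullet> mat 1\<bar> + \<bar>b\<bar> + 1) / - (Q \<bullet> N)"
    have "0 \<le> t"
      unfolding t_def using neg by (intro divide_nonneg_nonneg) auto
    with N have "nonneg_form (t *\<^sub>R N)"
      by (simp add: nonneg_form_def scaleR_matrix_vector_assoc[symmetric])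
    from T[OF shift[OF this, of 1]] have "b \<le> t * (Q \<bullet> N) + Q \<bullet> mat 1"
      by (simp add: inner_right_distrib)
    moreover have "t * (Q \<bullet> N) = - (\<bar>Q \<bullet> mat 1\<bar> + \<bar>b\<bar> + 1)"
      using neg by (simp add: t_def)
    ultimately show False by linarith
  qed
  have "nonneg_form Q"
    unfolding nonneg_form_def
  proof
    fix x :: "real^'m"
    have "nonneg_form (outer x x)"
      by (simp add: nonneg_form_def outer_mult_vec inner_commute)
    from pos[OF this] show "0 \<le> x \<bullet> (Q *v x)" by (simp add: inner_outer)
  qed
  moreover have "transpose Q = Q"
  proof -
    have le: "y \<bullet> (Q *v x) \<le> x \<bullet> (Q *v y)" for x y
    proof -
      have "nonneg_form (outer x y - outer y x)"
        by (simp add: nonneg_form_def outer_mult_vec matrix_vector_mult_diff_rdistrib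
            inner_diff_right inner_commute)
      from pos[OF this] show ?thesis by (simp add: inner_diff_right inner_outer)
    qed
    have "Q $ i $ j = axis i 1 \<bullet> (Q *v axis j 1)" for i j
      by (simp add: matrix_vector_mult_basis inner_axis' column_def)
    then show ?thesis
      using le by (simp add: vec_eq_iff transpose_def order_antisym)
  qed
  ultimately show thesis
    using that \<open>Q \<noteq> 0\<close> V \<open>b \<le> 0\<close> by (meson order_trans)
qed

lemma trace_pos:
  assumes "transpose Q = Q" and "nonneg_form Q" and "Q \<noteq> 0"
  shows "0 < trace Q"
proof -
  have nn: "0 \<le> Q $ i $ i" for i
    by (rule nonneg_form_diag[OF assms(2)])
  have "trace Q \<noteq> 0"
  proof
    assume "trace Q = 0"
    then have "Q $ i $ i = 0" for i
      using nn by (simp add: trace_def sum_nonneg_eq_0_iff)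
    then have "Q = 0"
      using nonneg_form_zero_diag[OF assms(1,2)] by (simp add: vec_eq_iff)
    with \<open>Q \<noteq> 0\<close> show False ..
  qed
  moreover have "0 \<le> trace Q"
    unfolding trace_def by (rule sum_nonneg) (rule nn)
  ultimately show ?thesis by simp
qed

section \<open>Block matrices and the pattern of a graph\<close>

lemma sum_UNIV_Plus:
  fixes f :: "'n::finite + 'n \<Rightarrow> 'a::comm_monoid_add"
  shows "sum f UNIV = (\<Sum>a\<in>UNIV. f (Inl a)) + (\<Sum>a\<in>UNIV. f (Inr a))"
  by (simp add: UNIV_Plus_UNIV[symmetric] sum.Plus del: UNIV_Plus_UNIV)

lemma block2_nth [simp]:
  "block2 A B C D $ Inl a $ Inl b = A $ a $ b" "block2 A B C D $ Inl a $ Inr b = B $ a $ b"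
  "block2 A B C D $ Inr a $ Inl b = C $ a $ b" "block2 A B C D $ Inr a $ Inr b = D $ a $ b"
  by (simp_all add: block2_def)

lemma block_matrix_eq_iff:
  "M = N \<longleftrightarrow> (\<forall>a b. M $ Inl a $ Inl b = N $ Inl a $ Inl b \<and> M $ Inl a $ Inr b = N $ Inl a $ Inr b \<and>
    M $ Inr a $ Inl b = N $ Inr a $ Inl b \<and> M $ Inr a $ Inr b = N $ Inr a $ Inr b)"
  for M N :: "'a^('n::finite + 'n)^('n + 'n)"
  by (simp only: vec_eq_iff split_sum_all all_conj_distrib conj_assoc)

lemma block2_eq_iff:
  "block2 A B C D = block2 A' B' C' D' \<longleftrightarrow> A = A' \<and> B = B' \<and> C = C' \<and> D = D'"
  by (auto simp: block_matrix_eq_iff vec_eq_iff)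

lemma map_matrix_block2:
  "map_matrix f (block2 A B C D) =
    block2 (map_matrix f A) (map_matrix f B) (map_matrix f C) (map_matrix f D)"
  by (simp add: block_matrix_eq_iff)

lemma transpose_block2:
  "transpose (block2 A B C D) = block2 (transpose A) (transpose C) (transpose B) (transpose D)"
  by (simp add: block_matrix_eq_iff transpose_def)

lemma symmetric_block2E:
  fixes Q :: "'a^('n::finite + 'n)^('n + 'n)"
  assumes "transpose Q = Q"
  obtains A B C where "Q = block2 A B (transpose B) C"
proof
  show "Q = block2 (\<chi> a b. Q $ Inl a $ Inl b) (\<chi> a b. Q $ Inl a $ Inr b)
      (transpose (\<chi> a b. Q $ Inl a $ Inr b)) (\<chi> a b. Q $ Inr a $ Inr b)"
    using symmetric_nth[OF assms] by (simp add: block_matrix_eq_iff transpose_def)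
qed

text \<open>Rows and columns of a block matrix are indexed by two copies of the vertex set; forgetting the
  copy lets one condition on entries express a condition on all four blocks.\<close>

definition vertex :: "'n + 'n \<Rightarrow> 'n" where
  "vertex = case_sum id id"

lemma vertex_simps [simp]: "vertex (Inl a) = a" "vertex (Inr a) = a"
  by (simp_all add: vertex_def)

definition supported_on :: "('n::finite \<times> 'n) set \<Rightarrow> 'a::zero^('n + 'n)^('n + 'n) \<Rightarrow> bool" where
  "supported_on G Q \<longleftrightarrow> (\<forall>i j. (vertex i, vertex j) \<notin> graph_refl G \<longrightarrow> Q $ i $ j = 0)"

definition agree_on ::
  "('n::finite \<times> 'n) set \<Rightarrow> 'a^('n + 'n)^('n + 'n) \<Rightarrow> 'a^('n + 'n)^('n + 'n) \<Rightarrow> bool" where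
  "agree_on G R M \<longleftrightarrow> (\<forall>i j. (vertex i, vertex j) \<in> graph_refl G \<longrightarrow> R $ i $ j = M $ i $ j)"

lemma supported_on_block2:
  "supported_on G (block2 A B C D) \<longleftrightarrow> (\<forall>a b. (a, b) \<notin> graph_refl G \<longrightarrow>
    A $ a $ b = 0 \<and> B $ a $ b = 0 \<and> C $ a $ b = 0 \<and> D $ a $ b = 0)"
  by (auto simp: supported_on_def split_sum_all)

lemma M2_pos_graph_system_of_real:
  fixes A B C :: "real^'n^'n"
  shows "map_matrix complex_of_real (block2 A B (transpose B) C) \<in> M2_pos (graph_system G) \<longleftrightarrow>
    transpose (block2 A B (transpose B) C) = block2 A B (transpose B) C \<and>
    nonneg_form (block2 A B (transpose B) C) \<and> supported_on G (block2 A B (transpose B) C)"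
  unfolding pos_semidef_of_real[symmetric] conj_assoc[symmetric]
  by (auto simp: M2_pos_def map_matrix_block2 block2_eq_iff mem_graph_system supported_on_block2)

definition osy_admissible :: "('n::finite \<times> 'n) set \<Rightarrow> complex^'n^'n \<Rightarrow> real \<Rightarrow> bool" where
  "osy_admissible G X l \<longleftrightarrow>
    (\<exists>K1 \<in> graph_system_perp G. \<exists>K2 \<in> graph_system_perp G. \<exists>K3 \<in> graph_system_perp G.
        block2 (mat (of_real l) + K1) (X + K2)
               (cadjoint X + cadjoint K2) (mat (of_real l) + K3) \<in> M2_pos UNIV)"

definition dilation :: "real^'n^'n \<Rightarrow> real^('n::finite + 'n)^('n + 'n)" where
  "dilation X = block2 0 X (transpose X) 0"

text \<open>For real \<open>X\<close> everything can be done over the reals: the real part of a positive semidefinite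
  matrix has nonnegative form. Conversely, symmetrizing \<open>R\<close> keeps its form and its prescribed entries,
  the latter because the graph is symmetric; the off-pattern part of the result supplies
  \<open>K\<^sub>1\<close>, \<open>K\<^sub>2\<close>, \<open>K\<^sub>3\<close>.\<close>

lemma osy_admissible_of_real:
  fixes X :: "real^'n^'n"
  assumes "graph_on G"
  shows "osy_admissible G (map_matrix complex_of_real X) l \<longleftrightarrow>
    (\<exists>R. nonneg_form R \<and> agree_on G R (l *\<^sub>R mat 1 + dilation X))"
proof
  have sym: "(b, a) \<in> graph_refl G" if "(a, b) \<in> graph_refl G" for a b
    using assms that by (auto simp: graph_on_def graph_refl_def dest: symD)
  {
    assume "osy_admissible G (map_matrix complex_of_real X) l"
    then obtain K1 K2 K3 where K: "K1 \<in> graph_system_perp G" "K2 \<in> graph_system_perp G"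
        "K3 \<in> graph_system_perp G" and
      P: "pos_semidef (block2 (mat (of_real l) + K1) (map_matrix complex_of_real X + K2)
        (cadjoint (map_matrix complex_of_real X) + cadjoint K2) (mat (of_real l) + K3))"
      by (auto simp: osy_admissible_def M2_pos_def)
    show "\<exists>R. nonneg_form R \<and> agree_on G R (l *\<^sub>R mat 1 + dilation X)"
    proof (intro exI conjI)
      show "nonneg_form (map_matrix Re (block2 (mat (of_real l) + K1)
          (map_matrix complex_of_real X + K2)
          (cadjoint (map_matrix complex_of_real X) + cadjoint K2) (mat (of_real l) + K3)))"
        by (rule pos_semidef_Re[OF P])
      show "agree_on G (map_matrix Re (block2 (mat (of_real l) + K1)
          (map_matrix complex_of_real X + K2)
          (cadjoint (map_matrix complex_of_real X) + cadjoint K2) (mat (of_real l) + K3)))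
          (l *\<^sub>R mat 1 + dilation X)"
        using K by (auto simp: agree_on_def split_sum_all dilation_def mem_graph_system_perp
            cadjoint_def transpose_def mat_def dest: sym)
    qed
  next
    assume "\<exists>R. nonneg_form R \<and> agree_on G R (l *\<^sub>R mat 1 + dilation X)"
    then obtain R where R: "nonneg_form R" and agree: "agree_on G R (l *\<^sub>R mat 1 + dilation X)"
      by blast
    define S where "S = (1/2) *\<^sub>R (R + transpose R)"
    have symS: "transpose S = S"
      by (simp add: S_def vec_eq_iff transpose_def add.commute)
    have S: "nonneg_form S"
      unfolding nonneg_form_def
    proof
      fix x
      have "x \<bullet> (transpose R *v x) = x \<bullet> (R *v x)"
        by (metis dot_lmul_matrix inner_commute transpose_matrix_vector)
      then show "0 \<le> x \<bullet> (S *v x)"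
        using R by (simp add: S_def nonneg_form_def scaleR_matrix_vector_assoc[symmetric]
            matrix_vector_mult_add_rdistrib inner_right_distrib del: transpose_matrix_vector)
    qed
    have agreeS: "agree_on G S (l *\<^sub>R mat 1 + dilation X)"
      unfolding agree_on_def
    proof (intro allI impI)
      fix i j :: "'n + 'n" assume ij: "(vertex i, vertex j) \<in> graph_refl G"
      have "(dilation X) $ j $ i = (dilation X) $ i $ j"
        by (cases i; cases j) (simp_all add: dilation_def transpose_def)
      with agree ij sym[OF ij] show "S $ i $ j = (l *\<^sub>R mat 1 + dilation X) $ i $ j"
        by (auto simp: agree_on_def S_def transpose_def mat_def)
    qed
    obtain A B C where ABC: "S = block2 A B (transpose B) C"
      by (rule symmetric_block2E[OF symS])
    show "osy_admissible G (map_matrix complex_of_real X) l"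
      unfolding osy_admissible_def
    proof (intro bexI)
      let ?c = "map_matrix complex_of_real"
      have "block2 (mat (of_real l) + ?c (A - mat l)) (?c X + ?c (B - X))
          (cadjoint (?c X) + cadjoint (?c (B - X))) (mat (of_real l) + ?c (C - mat l)) = ?c S"
        by (simp add: ABC block_matrix_eq_iff cadjoint_def transpose_def mat_def)
      then show "block2 (mat (of_real l) + ?c (A - mat l)) (?c X + ?c (B - X))
          (cadjoint (?c X) + cadjoint (?c (B - X))) (mat (of_real l) + ?c (C - mat l)) \<in> M2_pos UNIV"
        using symS S pos_semidef_of_real[of S] by (auto simp: M2_pos_def ABC map_matrix_block2)
      show "?c (A - mat l) \<in> graph_system_perp G" "?c (B - X) \<in> graph_system_perp G"
        "?c (C - mat l) \<in> graph_system_perp G"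
        using agreeS
        by (simp_all add: mem_graph_system_perp agree_on_def split_sum_all ABC dilation_def mat_def)
    qed
  }
qed

text \<open>The primal unknowns \<open>K\<^sub>1\<close>, \<open>K\<^sub>2\<close>, \<open>K\<^sub>3\<close> live at the positions where a dual matrix has to vanish, so
  they drop out of the pairing.\<close>

lemma inner_agree_on:
  fixes Q R M :: "real^('n::finite + 'n)^('n + 'n)"
  assumes "supported_on G Q" and "agree_on G R M"
  shows "Q \<bullet> R = Q \<bullet> M"
proof -
  have "Q $ i $ j * R $ i $ j = Q $ i $ j * M $ i $ j" for i j
    using assms unfolding supported_on_def agree_on_def
    by (cases "(vertex i, vertex j) \<in> graph_refl G") auto
  then show ?thesis
    by (simp only: inner_vec_def inner_real_def)
qed

lemma inner_mat_1: "Q \<bullet> mat 1 = trace (Q :: real^'m^'m)"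
  by (simp add: inner_vec_def mat_def trace_def if_distrib cong: if_cong)

lemma trace_block2:
  fixes A :: "'a::comm_semiring_1^'n::finite^'n"
  shows "trace (block2 A B C D) = trace (A + D)"
  by (simp add: trace_def sum_UNIV_Plus sum.distrib)

lemma inner_dilation:
  fixes X :: "real^'n^'n"
  shows "block2 A B (transpose B) C \<bullet> dilation X = 2 * trace (transpose X ** B)"
proof -
  have "(\<Sum>a\<in>UNIV. \<Sum>b\<in>UNIV. B $ b $ a * X $ b $ a) =
      (\<Sum>b\<in>UNIV. \<Sum>a\<in>UNIV. B $ b $ a * X $ b $ a)"
    by (rule sum.swap)
  then show ?thesis
    by (simp add: inner_vec_def sum_UNIV_Plus dilation_def transpose_def trace_def
        matrix_matrix_mult_def sum.distrib mult.commute)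
qed

text \<open>Congruence by \<open>diag(I, -I)\<close>. The duality argument pairs the primal block matrix with a dual one
  whose off-diagonal blocks carry the opposite sign.\<close>

lemma nonneg_form_block2_uminus:
  fixes A B C D :: "real^'n::finite^'n"
  assumes "nonneg_form (block2 A B C D)"
  shows "nonneg_form (block2 A (- B) (- C) D)"
  unfolding nonneg_form_def
proof
  fix x :: "real^('n + 'n)"
  define y :: "real^('n + 'n)" where "y = (\<chi> i. case i of Inl a \<Rightarrow> x $ i | Inr a \<Rightarrow> - x $ i)"
  have "x \<bullet> (block2 A (- B) (- C) D *v x) = y \<bullet> (block2 A B C D *v y)"
    by (simp add: quadratic_form_sum sum_UNIV_Plus y_def)
  then show "0 \<le> x \<bullet> (block2 A (- B) (- C) D *v x)"
    using assms by (simp add: nonneg_form_def)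
qed

definition dual_feasible ::
  "('n::finite \<times> 'n) set \<Rightarrow> real^'n^'n \<Rightarrow> real^'n^'n \<Rightarrow> real^'n^'n \<Rightarrow> bool" where
  "dual_feasible G A B C \<longleftrightarrow>
    map_matrix complex_of_real (block2 A B (transpose B) C) \<in> M2_pos (graph_system G) \<and>
    trace (A + C) = 1"

section \<open>Semidefinite duality\<close>

text \<open>Pairing the primal matrix with the sign-flipped dual matrix gives \<open>\<lambda> - 2 Tr(X\<^sup>T B) \<ge> 0\<close>.\<close>

lemma weak_duality:
  fixes X :: "real^'n^'n"
  assumes G: "graph_on G" and adm: "osy_admissible G (map_matrix complex_of_real X) l"
    and dual: "dual_feasible G A B C"
  shows "2 * trace (transpose X ** B) \<le> l"
proof -
  obtain R where R: "nonneg_form R" "agree_on G R (l *\<^sub>R mat 1 + dilation X)"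
    using adm osy_admissible_of_real[OF G] by blast
  define Q where "Q = block2 A (- B) (transpose (- B)) C"
  have "nonneg_form Q" "supported_on G Q" "transpose Q = Q"
    using dual nonneg_form_block2_uminus[of A B "transpose B" C]
    unfolding dual_feasible_def M2_pos_graph_system_of_real
    by (simp_all add: Q_def transpose_uminus supported_on_block2 transpose_block2 block2_eq_iff)
  then have "0 \<le> Q \<bullet> (l *\<^sub>R mat 1 + dilation X)"
    using nonneg_form_inner_nonneg[of Q R] R inner_agree_on by metis
  also have "\<dots> = l * trace (A + C) + 2 * trace (transpose X ** (- B))"
    by (simp add: inner_right_distrib inner_mat_1 Q_def trace_block2 inner_dilation)
  also have "\<dots> = l - 2 * trace (transpose X ** B)"
    using dual by (simp add: dual_feasible_def trace_def matrix_matrix_mult_def sum_negf)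
  finally show ?thesis by simp
qed

text \<open>The direction that produces dual solutions. Let \<open>V\<close> consist of all matrices that have the prescribed
  entries for some \<open>l\<close> in \<open>L\<close>. It is convex and contains no matrix of nonnegative form, so a
  hyperplane separates it from the positive definite cone. Since the entries of a member of \<open>V\<close> outside
  the pattern are arbitrary, the normal vector vanishes there. Scaled to trace 1 and with the sign of its
  off-diagonal blocks reversed, it is a dual solution. A single one serves all \<open>l\<close> in \<open>L\<close>,
  which is what makes attainment of the maximum automatic.\<close>

lemma dual_certificate:
  fixes X :: "real^'n^'n"
  assumes G: "graph_on G" and "convex L" and "L \<noteq> {}"
    and inf: "\<And>l. l \<in> L \<Longrightarrow> \<not> osy_admissible G (map_matrix complex_of_real X) l"
  obtains A B C where "dual_feasible G A B C"
    and "\<And>l. l \<in> L \<Longrightarrow> l \<le> 2 * trace (transpose X ** B)"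
proof -
  define V where "V = {R. \<exists>l\<in>L. agree_on G R (l *\<^sub>R mat 1 + dilation X)}"
  have "convex V"
  proof (rule convexI)
    fix R S and u v :: real
    assume RS: "R \<in> V" "S \<in> V" and uv: "0 \<le> u" "0 \<le> v" "u + v = 1"
    then obtain k l where "k \<in> L" "l \<in> L" and
      R: "agree_on G R (k *\<^sub>R mat 1 + dilation X)" and S: "agree_on G S (l *\<^sub>R mat 1 + dilation X)"
      by (auto simp: V_def)
    have "u *\<^sub>R k + v *\<^sub>R l \<in> L"
      using \<open>convex L\<close> \<open>k \<in> L\<close> \<open>l \<in> L\<close> uv by (rule convexD)
    moreover have "u * (k * m + d) + v * (l * m + d) = (u * k + v * l) * m + d" for m d :: real
    proof -
      have "u * (k * m + d) + v * (l * m + d) = (u * k + v * l) * m + (u + v) * d"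
        by (simp add: algebra_simps)
      then show ?thesis using uv(3) by simp
    qed
    then have "agree_on G (u *\<^sub>R R + v *\<^sub>R S) ((u *\<^sub>R k + v *\<^sub>R l) *\<^sub>R mat 1 + dilation X)"
      using R S by (simp add: agree_on_def)
    ultimately show "u *\<^sub>R R + v *\<^sub>R S \<in> V"
      unfolding V_def by blast
  qed
  moreover have base: "l *\<^sub>R mat 1 + dilation X \<in> V" if "l \<in> L" for l
    using that by (auto simp: V_def agree_on_def)
  then have "V \<noteq> {}"
    using \<open>L \<noteq> {}\<close> by blast
  moreover have "\<not> nonneg_form M" if "M \<in> V" for M
    using that inf unfolding V_def osy_admissible_of_real[OF G] by blast
  ultimately obtain Q where Q: "Q \<noteq> 0" "transpose Q = Q" "nonneg_form Q"
    and V: "\<And>M. M \<in> V \<Longrightarrow> Q \<bullet> M \<le> 0"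
    using separate_from_positive_definite by blast
  have supp: "supported_on G Q"
    unfolding supported_on_def
  proof (intro allI impI, rule ccontr)
    fix i j assume off: "(vertex i, vertex j) \<notin> graph_refl G" and nz: "Q $ i $ j \<noteq> 0"
    obtain l where "l \<in> L" using \<open>L \<noteq> {}\<close> by blast
    \<comment> \<open>move along the matrix unit at \<open>(i, j)\<close>, which stays in \<open>V\<close>, until the functional is 1\<close>
    define M where "M = l *\<^sub>R mat 1 + dilation X"
    define t where "t = (1 - Q \<bullet> M) / Q $ i $ j"
    have "agree_on G (M + t *\<^sub>R axis i (axis j 1)) M"
      using off by (auto simp: agree_on_def axis_def)
    then have "M + t *\<^sub>R axis i (axis j 1) \<in> V"
      using \<open>l \<in> L\<close> by (auto simp: V_def M_def)
    from V[OF this] have "Q \<bullet> M + t * Q $ i $ j \<le> 0"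
      by (simp add: inner_right_distrib inner_axis)
    then show False
      using nz by (simp add: t_def)
  qed
  have tr: "0 < trace Q"
    using Q by (intro trace_pos)
  define P where "P = (1 / trace Q) *\<^sub>R Q"
  have symP: "transpose P = P"
    using Q(2) by (simp add: P_def vec_eq_iff transpose_def)
  have P: "nonneg_form P"
    using Q(3) tr by (simp add: P_def nonneg_form_def scaleR_matrix_vector_assoc[symmetric])
  have suppP: "supported_on G P"
    using supp by (simp add: P_def supported_on_def)
  have trP: "trace P = 1"
    using tr by (simp add: P_def flip: inner_mat_1)
  obtain A B C where ABC: "P = block2 A B (transpose B) C"
    by (rule symmetric_block2E[OF symP])
  show thesis
  proof
    show "dual_feasible G A (- B) C"
      using P symP suppP trP nonneg_form_block2_uminus[of A B "transpose B" C]
      unfolding dual_feasible_def M2_pos_graph_system_of_real ABC trace_block2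
      by (simp add: transpose_uminus supported_on_block2 transpose_block2 block2_eq_iff)
    fix l assume "l \<in> L"
    have "P \<bullet> (l *\<^sub>R mat 1 + dilation X) \<le> 0"
      using V[OF base[OF \<open>l \<in> L\<close>]] tr by (simp add: P_def divide_nonpos_pos)
    moreover have "P \<bullet> (l *\<^sub>R mat 1 + dilation X) = l + 2 * trace (transpose X ** B)"
      by (simp add: inner_right_distrib inner_mat_1 trP) (simp add: ABC inner_dilation)
    ultimately show "l \<le> 2 * trace (transpose X ** (- B))"
      by (simp add: trace_def matrix_matrix_mult_def sum_negf)
  qed
qed

theorem proposition5p8:
  fixes G :: "('n::finite \<times> 'n) set" and X :: "real^'n^'n"
  assumes "graph_on G"
  shows "is_maximum (osy_norm G (map_matrix complex_of_real X))
    {2 * trace (transpose X ** B) | A B C :: real^'n^'n.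
       map_matrix complex_of_real (block2 A B (transpose B) C) \<in> M2_pos (graph_system G) \<and>
       trace (A + C) = 1}"
proof -
  define adm where "adm = {l. osy_admissible G (map_matrix complex_of_real X) l}"
  have norm: "osy_norm G (map_matrix complex_of_real X) = Inf adm"
    by (simp add: osy_norm_def adm_def osy_admissible_def)
  \<comment> \<open>otherwise one dual solution would have a value above every real number\<close>
  have "adm \<noteq> {}"
  proof
    assume "adm = {}"
    obtain A B C where "dual_feasible G A B C" and le: "\<And>l. l \<le> 2 * trace (transpose X ** B)"
    proof (rule dual_certificate[OF assms, of UNIV X])
      show "\<not> osy_admissible G (map_matrix complex_of_real X) l" for l
        using \<open>adm = {}\<close> by (simp add: adm_def)
    qed auto
    from le[of "2 * trace (transpose X ** B) + 1"] show False by simp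
  qed
  \<comment> \<open>diagonal entries are part of the pattern, so \<open>l\<close> is a diagonal entry of a matrix of nonnegative form\<close>
  have "bdd_below adm"
  proof (rule bdd_belowI)
    fix l assume "l \<in> adm"
    then obtain R where R: "nonneg_form R" and agree: "agree_on G R (l *\<^sub>R mat 1 + dilation X)"
      using osy_admissible_of_real[OF assms] by (auto simp: adm_def)
    obtain a :: 'n where True by blast
    have "R $ Inl a $ Inl a = l"
      using agree by (auto simp: agree_on_def graph_refl_def dilation_def mat_def)
    with nonneg_form_diag[OF R, of "Inl a"] show "0 \<le> l" by simp
  qed
  obtain A B C where dual: "dual_feasible G A B C"
    and le: "\<And>l. l < Inf adm \<Longrightarrow> l \<le> 2 * trace (transpose X ** B)"
  proof (rule dual_certificate[OF assms, of "{..<Inf adm}" X])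
    fix l assume "l \<in> {..<Inf adm}"
    then show "\<not> osy_admissible G (map_matrix complex_of_real X) l"
      using cInf_lower[OF _ \<open>bdd_below adm\<close>, of l] by (auto simp: adm_def)
  qed auto
  have upper: "2 * trace (transpose X ** B') \<le> Inf adm" if "dual_feasible G A' B' C'" for A' B' C'
    using \<open>adm \<noteq> {}\<close> weak_duality[OF assms _ that, of X]
    by (intro cInf_greatest) (auto simp: adm_def)
  have "Inf adm = 2 * trace (transpose X ** B)"
    using le by (intro antisym[OF dense_le upper[OF dual]])
  then show ?thesis
    using dual upper unfolding is_maximum_def norm dual_feasible_def by auto
qed

end
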